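(* Let $G$ and $H$ be rooted graphs. For any integers $m,h\ge 1$ and $g,k\ge 0$, \begin{align*} \frac{X_{S^{ghk}(G,H,K_m)}}{(m-1)!} &=\sum_{z=0}^{m-1}e_{m-1-z}\,X_{P^{g+h+k+z}(G,H)} -\sum_{\substack{a+b+c=k+m-2\\ a,b,c\ge 0,\ a\le m-1}}(1-a)\,e_a\,X_{G^{b+g}}\,X_{H^{c+h}}\\ &\qquad+\frac{1}{(m-1)!}\sum_{z=0}^{k-1}X_{K_m^{z}}\,X_{P^{g+h+k-z-1}(G,H)}. \end{align*}
   Context: All graphs are finite simple graphs. The chromatic symmetric function of a graph $G$ is $X_G=\sum_{\kappa}\prod_{v\in V(G)}x_{\kappa(v)}$, where $\kappa$ ranges over proper colorings $\kappa:V(G)\to\{1,2,\dots\}$; $e_a$ is the $a$-th elementary symmetric function, $e_0=1$. $K_m$ is the complete graph, rooted at any vertex. For nonnegative integers $\tau_1,\tau_2,\tau_3$ and rooted graphs $(G_i,u_i)$, $S^{\tau_1\tau_2\tau_3}(G_1,G_2,G_3)$ is obtained by taking a center vertex $c$ and three paths from $c$, disjoint except at $c$, of lengths $\tau_1,\tau_2,\tau_3$, and identifying $u_i$ with the far end of the $i$-th path (with $c$ itself if $\tau_i=0$), the $G_i$ being disjoint. For rooted graphs $(G,u)$, $(H,v)$ and $k\ge0$, $P^k(G,H)$ is obtained from the disjoint union of $G$ and $H$ by adding a path of length $k$ joining $u$ and $v$ (for $k=0$ identifying them), and $G^k=P^k(G,K_1)$ is $G$ with a pendant path of length $k$ at its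 root; in particular $K_m^z$ is the lollipop ($K_m$ with a pendant path of length $z$). *)

theory Defs
  imports Complex_Main "HOL-Library.FuncSet"
begin

record 'v rgraph =
  verts :: "'v set"
  adj   :: "'v \<Rightarrow> 'v \<Rightarrow> bool"
  root  :: 'v

definition rgraph_wf :: "'v rgraph \<Rightarrow> bool" where
  "rgraph_wf G \<longleftrightarrow> finite (verts G) \<and> root G \<in> verts G \<and>
     (\<forall>x y. adj G x y \<longrightarrow> x \<in> verts G \<and> y \<in> verts G \<and> x \<noteq> y \<and> adj G y x)"

definition Kc :: "nat \<Rightarrow> nat rgraph" where
  "Kc m = \<lparr>verts = {0..<m}, adj = (\<lambda>x y. x \<in> {0..<m} \<and> y \<in> {0..<m} \<and> x \<noteq> y), root = 0\<rparr>"

text \<open>P^k(G,H): disjoint union of G and H plus a path of length k joining the roots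
  (the roots are identified when k = 0). Rooted at the root of G.\<close>
definition P_graph :: "nat \<Rightarrow> 'a rgraph \<Rightarrow> 'b rgraph \<Rightarrow> ('a + 'b + nat) rgraph" where
  "P_graph k G H = (let
     hm = (\<lambda>w. if k = 0 \<and> w = root H then Inl (root G) else Inr (Inl w));
     pv = (\<lambda>i. if i = 0 then Inl (root G) else if i = k then hm (root H) else Inr (Inr i))
   in \<lparr>verts = Inl ` verts G \<union> hm ` verts H \<union> pv ` {0..k},
       adj = (\<lambda>x y. (\<exists>a b. x = Inl a \<and> y = Inl b \<and> adj G a b)
                  \<or> (\<exists>a b. x = hm a \<and> y = hm b \<and> adj H a b)
                  \<or> (\<exists>i<k. (x = pv i \<and> y = pv (Suc i)) \<or> (x = pv (Suc i) \<and> y = pv i))),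
       root = Inl (root G)\<rparr>)"

definition pend :: "nat \<Rightarrow> 'a rgraph \<Rightarrow> ('a + nat + nat) rgraph" where
  "pend k G = P_graph k G (Kc 1)"

text \<open>S^{t1 t2 t3}(G1,G2,G3): centre c, three internally disjoint paths from c of
  lengths t1,t2,t3, the far end of the i-th path identified with the root of Gi
  (with c itself if ti = 0). Inner vertices of path i are Inr (i,j), 0<j<ti.\<close>
definition S_graph :: "nat \<Rightarrow> nat \<Rightarrow> nat \<Rightarrow> 'a rgraph \<Rightarrow> 'b rgraph \<Rightarrow> 'c rgraph
    \<Rightarrow> (('a + 'b + 'c) + nat \<times> nat) rgraph" where
  "S_graph t1 t2 t3 G1 G2 G3 = (let
     c = Inr (0, 0);
     e1 = (\<lambda>w. if t1 = 0 \<and> w = root G1 then c else Inl (Inl w));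
     e2 = (\<lambda>w. if t2 = 0 \<and> w = root G2 then c else Inl (Inr (Inl w)));
     e3 = (\<lambda>w. if t3 = 0 \<and> w = root G3 then c else Inl (Inr (Inr w)));
     q = (\<lambda>i t r j. if j = 0 then c else if j = t then r else Inr (i, j));
     q1 = q (1::nat) t1 (e1 (root G1));
     q2 = q 2 t2 (e2 (root G2));
     q3 = q 3 t3 (e3 (root G3));
     pe = (\<lambda>p t x y. \<exists>j<t. (x = p j \<and> y = p (Suc j)) \<or> (x = p (Suc j) \<and> y = p j))
   in \<lparr>verts = {c} \<union> e1 ` verts G1 \<union> e2 ` verts G2 \<union> e3 ` verts G3
                 \<union> q1 ` {0..t1} \<union> q2 ` {0..t2} \<union> q3 ` {0..t3},
       adj = (\<lambda>x y. (\<exists>a b. x = e1 a \<and> y = e1 b \<and> adj G1 a b)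
                  \<or> (\<exists>a b. x = e2 a \<and> y = e2 b \<and> adj G2 a b)
                  \<or> (\<exists>a b. x = e3 a \<and> y = e3 b \<and> adj G3 a b)
                  \<or> pe q1 t1 x y \<or> pe q2 t2 x y \<or> pe q3 t3 x y),
       root = c\<rparr>)"

text \<open>A series is given by its coefficient function on exponent vectors
  alpha :: nat => nat (alpha i = exponent of x_i); coefficients rational.\<close>
type_synonym sf = "(nat \<Rightarrow> nat) \<Rightarrow> rat"

definition sf_add :: "sf \<Rightarrow> sf \<Rightarrow> sf" where
  "sf_add f g = (\<lambda>\<alpha>. f \<alpha> + g \<alpha>)"

definition sf_diff :: "sf \<Rightarrow> sf \<Rightarrow> sf" where
  "sf_diff f g = (\<lambda>\<alpha>. f \<alpha> - g \<alpha>)"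

definition sf_smult :: "rat \<Rightarrow> sf \<Rightarrow> sf" where
  "sf_smult c f = (\<lambda>\<alpha>. c * f \<alpha>)"

definition sf_mult :: "sf \<Rightarrow> sf \<Rightarrow> sf" where
  "sf_mult f g = (\<lambda>\<alpha>. \<Sum>\<beta>\<in>{\<beta>. \<forall>i. \<beta> i \<le> \<alpha> i}. f \<beta> * g (\<lambda>i. \<alpha> i - \<beta> i))"

definition sf_sum :: "('i \<Rightarrow> sf) \<Rightarrow> 'i set \<Rightarrow> sf" where
  "sf_sum F I = (\<lambda>\<alpha>. \<Sum>i\<in>I. F i \<alpha>)"

definition esym :: "nat \<Rightarrow> sf" where
  "esym a = (\<lambda>\<alpha>. if (\<forall>i. \<alpha> i \<le> 1) \<and> finite {i. \<alpha> i \<noteq> 0} \<and> card {i. \<alpha> i \<noteq> 0} = a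
                  then 1 else 0)"

definition chrom :: "'v rgraph \<Rightarrow> sf" where
  "chrom G = (\<lambda>\<alpha>. of_nat (card {\<kappa> \<in> verts G \<rightarrow>\<^sub>E (UNIV :: nat set).
       (\<forall>x\<in>verts G. \<forall>y\<in>verts G. adj G x y \<longrightarrow> \<kappa> x \<noteq> \<kappa> y) \<and>
       (\<forall>i. card {v \<in> verts G. \<kappa> v = i} = \<alpha> i)}))"

end

theory Submission
  imports Defs "HOL-Library.Poly_Mapping"
begin

text \<open>A rooted graph is encoded by the function \<open>f\<close> sending a color \<open>i\<close> to the weighted number of its proper
  colorings with root color \<open>i\<close>, where the weight of the root itself is omitted. Gluing at the roots
  multiplies these functions, and a pendant edge at the root acts by the operator
  \<open>(T f) i = s f - x i * f i\<close> with \<open>s f = (\<Sum>i. x i * f i)\<close>, which is self-adjoint for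
  \<open>(f, g) \<mapsto> s (f * g)\<close>. Hence the left-hand side is \<open>s (T^g G * T^h H * T^k K)\<close>, where the clique is
  \<open>K i = (m - 1)! M i\<close> and \<open>M i\<close> is the elementary symmetric polynomial of degree \<open>m - 1\<close> in the
  variables other than \<open>x i\<close>. Moving the factors \<open>T\<close> from the clique to \<open>G\<close> one at a time produces the last
  sum of the formula and reduces to \<open>k = 0\<close>; there the rules \<open>M_(n+1) = e_(n+1) - x M_n\<close> and
  \<open>T M_n = n e_(n+1) + M_(n+1)\<close> yield the other two sums.

  These computations take place in finitely many variables over an arbitrary commutative ring; the
  coefficients of the power series are read off by specializing to polynomials.\<close>

subsection \<open>Weighted sums over a finite set of colors\<close>

locale color_weights =
  fixes C :: "'c set" and x :: "'c \<Rightarrow> 'r::comm_ring_1"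
  assumes finite_C: "finite C"
begin

definition wsum :: "('c \<Rightarrow> 'r) \<Rightarrow> 'r" where
  "wsum f = (\<Sum>i\<in>C. x i * f i)"

definition step :: "('c \<Rightarrow> 'r) \<Rightarrow> 'c \<Rightarrow> 'r" where
  "step f i = wsum f - x i * f i"

definition elem :: "'c set \<Rightarrow> nat \<Rightarrow> 'r" where
  "elem D n = (\<Sum>S | S \<subseteq> D \<and> card S = n. \<Prod>i\<in>S. x i)"

definition clique_at :: "nat \<Rightarrow> 'c \<Rightarrow> 'r" where
  "clique_at n i = elem (C - {i}) n"

section \<open>Linearity and self-adjointness of the pendant-edge operator\<close>

lemma wsum_cong: "(\<And>i. i \<in> C \<Longrightarrow> f i = g i) \<Longrightarrow> wsum f = wsum g"
  unfolding wsum_def by (intro sum.cong) auto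

lemma step_cong: "(\<And>i. i \<in> C \<Longrightarrow> f i = g i) \<Longrightarrow> i \<in> C \<Longrightarrow> step f i = step g i"
  unfolding step_def using wsum_cong[of f g] by simp

text \<open>Root polynomials are computed only at colors in \<open>C\<close>, so rewriting below
  powers of \<open>step\<close> has to respect that restriction.\<close>

lemma step_power_cong:
  "(\<And>i. i \<in> C \<Longrightarrow> f i = g i) \<Longrightarrow> i \<in> C \<Longrightarrow> (step ^^ k) f i = (step ^^ k) g i"
  by (induction k arbitrary: i) (auto intro: step_cong)

lemma wsum_add: "wsum (\<lambda>i. f i + g i) = wsum f + wsum g"
  by (simp add: wsum_def algebra_simps sum.distrib)

lemma wsum_diff: "wsum (\<lambda>i. f i - g i) = wsum f - wsum g"
  by (simp add: wsum_def algebra_simps sum_subtractf)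

lemma wsum_scale: "wsum (\<lambda>i. a * f i) = a * wsum f"
  by (simp add: wsum_def sum_distrib_left mult.left_commute)

lemma step_scale: "step (\<lambda>i. a * f i) = (\<lambda>i. a * step f i)"
  by (simp add: step_def wsum_scale fun_eq_iff algebra_simps)

lemma step_power_scale: "(step ^^ k) (\<lambda>i. a * f i) = (\<lambda>i. a * (step ^^ k) f i)"
  by (induction k) (auto simp: step_scale)

text \<open>Multiplying by \<open>step g\<close> means multiplying by the constant
  \<open>wsum g\<close> and subtracting the diagonal term. The result is symmetric in
  \<open>f\<close> and \<open>g\<close>, whence the self-adjointness.\<close>

lemma wsum_mult_step: "wsum (\<lambda>i. f i * step g i) = wsum f * wsum g - wsum (\<lambda>i. x i * (f i * g i))"
proof -
  have "(\<lambda>i. f i * step g i) = (\<lambda>i. wsum g * f i - x i * (f i * g i))"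
    by (simp add: step_def fun_eq_iff algebra_simps)
  then show ?thesis by (simp only: wsum_diff wsum_scale mult.commute[of "wsum f"])
qed

lemma wsum_step_adjoint: "wsum (\<lambda>i. f i * step g i) = wsum (\<lambda>i. step f i * g i)"
  using wsum_mult_step[of f g] wsum_mult_step[of g f] by (simp add: mult.commute)

text \<open>All steps can be collected on one factor: a path join of two graphs depends only on the
  total length of the path.\<close>

lemma wsum_step_power_adjoint:
  "wsum (\<lambda>i. (step ^^ a) f i * (step ^^ b) g i) = wsum (\<lambda>i. f i * (step ^^ (a + b)) g i)"
proof (induction a arbitrary: b)
  case (Suc a)
  have "wsum (\<lambda>i. (step ^^ Suc a) f i * (step ^^ b) g i) = wsum (\<lambda>i. (step ^^ a) f i * (step ^^ Suc b) g i)"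
    using wsum_step_adjoint[of "(step ^^ a) f" "(step ^^ b) g"] by simp
  then show ?case using Suc[of "Suc b"] by simp
qed simp

text \<open>The constant 1 is the root polynomial of a single vertex, so this turns a path join with
  \<open>Kc 1\<close> into a pendant path.\<close>

lemma wsum_step_power_one: "wsum (\<lambda>i. f i * (step ^^ k) (\<lambda>_. 1) i) = wsum ((step ^^ k) f)"
  using wsum_step_power_adjoint[of k f 0 "\<lambda>_. 1"] by simp

text \<open>The weighted form of the triple-deletion rule.\<close>

lemma wsum_move_step:
  "wsum (\<lambda>i. f i * g i * step d i) =
     wsum (\<lambda>i. step f i * g i * d i) + wsum (\<lambda>i. f i * g i) * wsum d - wsum f * wsum (\<lambda>i. g i * d i)"
proof -
  have 1: "wsum (\<lambda>i. step f i * g i * d i) = wsum (\<lambda>i. g i * d i * step f i)"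
    and 2: "wsum (\<lambda>i. x i * (g i * d i * f i)) = wsum (\<lambda>i. x i * (f i * g i * d i))"
    by (simp_all add: ac_simps)
  show ?thesis unfolding 1 wsum_mult_step 2 by (simp add: mult.commute)
qed

text \<open>Iterates \<open>wsum_move_step\<close>. In move \<open>j\<close> the factor
  \<open>f\<close> already carries \<open>p + j\<close> steps and \<open>k - 1 - j\<close> remain on
  \<open>d\<close>; each move leaves one term in either correction sum.\<close>

lemma wsum_move_step_power:
  "wsum (\<lambda>i. (step ^^ p) f i * g i * (step ^^ k) d i) =
     wsum (\<lambda>i. (step ^^ (p + k)) f i * g i * d i)
     + (\<Sum>j<k. wsum (\<lambda>i. (step ^^ (p + j)) f i * g i) * wsum ((step ^^ (k - 1 - j)) d))
     - (\<Sum>j<k. wsum ((step ^^ (p + j)) f) * wsum (\<lambda>i. g i * (step ^^ (k - 1 - j)) d i))"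
proof (induction k arbitrary: p)
  case (Suc k)
  show ?case
    using wsum_move_step[of "(step ^^ p) f" g "(step ^^ k) d"] Suc[of "Suc p"]
    by (simp add: sum.lessThan_Suc_shift del: sum.lessThan_Suc)
qed simp

section \<open>Elementary symmetric polynomials\<close>

lemma elem_0: "finite D \<Longrightarrow> elem D 0 = 1"
proof -
  assume "finite D"
  then have "{S. S \<subseteq> D \<and> card S = 0} = {{}}" by (auto dest: finite_subset)
  then show ?thesis by (simp add: elem_def)
qed

text \<open>The subsets of size \<open>Suc n\<close> are split according to whether they contain
  \<open>i\<close>.\<close>

lemma elem_insert:
  assumes "finite D" "i \<notin> D"
  shows "elem (insert i D) (Suc n) = elem D (Suc n) + x i * elem D n"
proof -
  let ?A = "{S. S \<subseteq> D \<and> card S = Suc n}" and ?B = "{S. S \<subseteq> D \<and> card S = n}"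
  have fin: "finite ?A" "finite ?B" using assms by auto
  have split: "{S. S \<subseteq> insert i D \<and> card S = Suc n} = ?A \<union> insert i ` ?B" (is "?L = ?R")
  proof (intro equalityI subsetI)
    fix S assume S: "S \<in> ?L"
    then have fS: "finite S" using assms by (auto dest: finite_subset)
    show "S \<in> ?R"
    proof (cases "i \<in> S")
      case True
      then have "S = insert i (S - {i})" "S - {i} \<in> ?B" using S fS by auto
      then show ?thesis by blast
    qed (use S in auto)
  next
    fix S assume "S \<in> ?R"
    then show "S \<in> ?L"
    proof
      assume "S \<in> insert i ` ?B"
      then obtain U where U: "U \<subseteq> D" "card U = n" "S = insert i U" by auto
      then have "finite U" "i \<notin> U" using assms by (auto dest: finite_subset)
      then show ?thesis using U by auto
    qed auto
  qed
  have "inj_on (insert i) ?B"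
  proof (rule inj_onI)
    fix S U assume "S \<in> ?B" "U \<in> ?B" and eq: "insert i S = insert i U"
    then have "i \<notin> S" "i \<notin> U" using assms by auto
    then show "S = U" using insert_ident[of i S U] eq by blast
  qed
  then have "(\<Sum>S\<in>insert i ` ?B. \<Prod>i\<in>S. x i) = (\<Sum>S\<in>?B. x i * (\<Prod>i\<in>S. x i))"
    using assms by (subst sum.reindex) (auto intro!: sum.cong prod.insert dest: finite_subset)
  moreover have "?A \<inter> insert i ` ?B = {}" using assms by auto
  ultimately show ?thesis
    unfolding elem_def split by (simp add: sum.union_disjoint fin sum_distrib_left)
qed

lemma elem_remove: "finite D \<Longrightarrow> i \<in> D \<Longrightarrow> elem D (Suc n) = elem (D - {i}) (Suc n) + x i * elem (D - {i}) n"
  using elem_insert[of "D - {i}" i n] by (simp add: insert_absorb)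

text \<open>Euler's identity: each monomial of the elementary symmetric polynomial of degree n + 1 arises
  once for each of its n + 1 variables.\<close>

lemma sum_elem_remove:
  assumes "finite D"
  shows "(\<Sum>i\<in>D. x i * elem (D - {i}) n) = of_nat (Suc n) * elem D (Suc n)"
proof -
  let ?A = "{S. S \<subseteq> D \<and> card S = Suc n}"
  have fin: "finite ?A" using assms by auto
  have "(\<Sum>i\<in>D. x i * elem (D - {i}) n) = (\<Sum>i\<in>D. \<Sum>S | S \<in> ?A \<and> i \<in> S. \<Prod>j\<in>S. x j)"
  proof (intro sum.cong refl)
    fix i assume i: "i \<in> D"
    have "(\<Sum>S | S \<subseteq> D - {i} \<and> card S = n. x i * (\<Prod>j\<in>S. x j)) = (\<Sum>S | S \<in> ?A \<and> i \<in> S. \<Prod>j\<in>S. x j)"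
    proof (rule sum.reindex_bij_witness[of _ "\<lambda>S. S - {i}" "insert i"])
      fix S assume "S \<in> {S. S \<subseteq> D - {i} \<and> card S = n}"
      moreover from this have "finite S" "i \<notin> S" using assms by (auto dest: finite_subset)
      ultimately show "insert i S - {i} = S" "insert i S \<in> {S. S \<in> ?A \<and> i \<in> S}"
        "(\<Prod>j\<in>insert i S. x j) = x i * (\<Prod>j\<in>S. x j)"
        using i by (auto intro: prod.insert)
    next
      fix S assume "S \<in> {S. S \<in> ?A \<and> i \<in> S}"
      moreover from this have "finite S" using assms by (auto dest: finite_subset)
      ultimately show "insert i (S - {i}) = S" "S - {i} \<in> {S. S \<subseteq> D - {i} \<and> card S = n}"
        by auto
    qed
    then show "x i * elem (D - {i}) n = (\<Sum>S | S \<in> ?A \<and> i \<in> S. \<Prod>j\<in>S. x j)"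
      by (simp add: elem_def sum_distrib_left)
  qed
  also have "\<dots> = (\<Sum>S\<in>?A. \<Sum>i | i \<in> D \<and> i \<in> S. \<Prod>j\<in>S. x j)"
    by (rule sum.swap_restrict) (use assms fin in auto)
  also have "\<dots> = (\<Sum>S\<in>?A. of_nat (Suc n) * (\<Prod>j\<in>S. x j))"
  proof (intro sum.cong refl)
    fix S assume "S \<in> ?A"
    then have "{i. i \<in> D \<and> i \<in> S} = S" "card S = Suc n" by auto
    then show "(\<Sum>i | i \<in> D \<and> i \<in> S. \<Prod>j\<in>S. x j) = of_nat (Suc n) * (\<Prod>j\<in>S. x j)"
      by (simp only: sum_constant)
  qed
  finally show ?thesis by (simp add: elem_def sum_distrib_left)
qed

section \<open>The clique as a factor in weighted sums\<close>

lemma clique_at_0: "clique_at 0 i = 1"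
  by (simp add: clique_at_def elem_0 finite_C)

lemma clique_at_Suc: "i \<in> C \<Longrightarrow> clique_at (Suc n) i = elem C (Suc n) - x i * clique_at n i"
  using elem_remove[OF finite_C, of i n] by (simp add: clique_at_def)

text \<open>Euler's identity makes \<open>wsum (clique_at n)\<close> equal to \<open>n + 1\<close>
  copies of \<open>elem C (Suc n)\<close>. One copy absorbs \<open>- x i * clique_at n i\<close> and
  becomes \<open>clique_at (Suc n) i\<close>; \<open>n\<close> copies remain.\<close>

lemma step_clique_at:
  assumes "i \<in> C"
  shows "step (clique_at n) i = of_nat n * elem C (Suc n) + clique_at (Suc n) i"
proof -
  have "wsum (clique_at n) = of_nat (Suc n) * elem C (Suc n)"
    using sum_elem_remove[OF finite_C, of n] by (simp add: wsum_def clique_at_def)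
  then show ?thesis using assms by (simp add: step_def clique_at_Suc algebra_simps)
qed

text \<open>Solving \<open>step_clique_at\<close> for \<open>clique_at (Suc n)\<close> and moving
  \<open>step\<close> to \<open>f\<close> gives a recursion in \<open>n\<close>, with the hypothesis
  used at \<open>step f\<close>. The new term has coefficient \<open>- n\<close>, which is
  \<open>1 - a\<close> at \<open>a = Suc n\<close>; this is the origin of the factor
  \<open>1 - a\<close> in the theorem.\<close>

lemma wsum_clique_at:
  "wsum (\<lambda>i. f i * clique_at n i) = (\<Sum>a\<le>n. (1 - of_nat a) * (elem C a * wsum ((step ^^ (n - a)) f)))"
proof (induction n arbitrary: f)
  case 0
  then show ?case by (simp add: clique_at_0 elem_0 finite_C)
next
  case (Suc n)
  have "wsum (\<lambda>i. step f i * clique_at n i) = wsum (\<lambda>i. f i * step (clique_at n) i)"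
    by (rule wsum_step_adjoint[symmetric])
  also have "\<dots> = wsum (\<lambda>i. of_nat n * elem C (Suc n) * f i + f i * clique_at (Suc n) i)"
    by (rule wsum_cong) (simp add: step_clique_at algebra_simps)
  also have "\<dots> = of_nat n * elem C (Suc n) * wsum f + wsum (\<lambda>i. f i * clique_at (Suc n) i)"
    by (simp add: wsum_add wsum_scale)
  finally have "wsum (\<lambda>i. f i * clique_at (Suc n) i) =
      wsum (\<lambda>i. step f i * clique_at n i) - of_nat n * elem C (Suc n) * wsum f"
    by (simp add: algebra_simps)
  also have "wsum (\<lambda>i. step f i * clique_at n i) =
      (\<Sum>a\<le>n. (1 - of_nat a) * (elem C a * wsum ((step ^^ (Suc n - a)) f)))"
    unfolding Suc by (intro sum.cong refl) (simp add: Suc_diff_le funpow_swap1)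
  finally show ?case by (simp add: algebra_simps)
qed

text \<open>The case of a clique at the center. By \<open>clique_at_Suc\<close> one elementary
  symmetric term splits off; \<open>wsum_mult_step\<close> turns the remaining diagonal term into a
  separated product and the same expression with \<open>p\<close> raised and \<open>n\<close>
  lowered by one.\<close>

lemma wsum_product_clique_at:
  "wsum (\<lambda>i. (step ^^ p) f i * g i * clique_at n i) =
     (\<Sum>z\<le>n. elem C (n - z) * wsum (\<lambda>i. (step ^^ (p + z)) f i * g i))
     - (\<Sum>j<n. wsum ((step ^^ (p + j)) f) * wsum (\<lambda>i. g i * clique_at (n - 1 - j) i))"
proof (induction n arbitrary: p)
  case 0
  then show ?case by (simp add: clique_at_0 elem_0 finite_C)
next
  case (Suc n)
  let ?f = "(step ^^ p) f"
  have "wsum (\<lambda>i. ?f i * g i * clique_at (Suc n) i) =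
      wsum (\<lambda>i. elem C (Suc n) * (?f i * g i) - x i * (g i * clique_at n i * ?f i))"
    by (rule wsum_cong) (simp add: clique_at_Suc algebra_simps)
  also have "\<dots> = elem C (Suc n) * wsum (\<lambda>i. ?f i * g i) - wsum (\<lambda>i. x i * (g i * clique_at n i * ?f i))"
    by (simp only: wsum_diff wsum_scale)
  also have "wsum (\<lambda>i. x i * (g i * clique_at n i * ?f i)) =
      wsum ?f * wsum (\<lambda>i. g i * clique_at n i) - wsum (\<lambda>i. g i * clique_at n i * step ?f i)"
    using wsum_mult_step[of "\<lambda>i. g i * clique_at n i" ?f] by (simp add: mult.commute)
  also have "wsum (\<lambda>i. g i * clique_at n i * step ?f i) = wsum (\<lambda>i. (step ^^ Suc p) f i * g i * clique_at n i)"
    by (simp add: ac_simps)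
  finally show ?case
    unfolding Suc by (simp add: sum.lessThan_Suc_shift sum.atMost_Suc_shift del: sum.lessThan_Suc sum.atMost_Suc)
qed

text \<open>Here \<open>c\<close> is determined by \<open>a\<close> and \<open>b\<close>, and the
  triples are sorted by \<open>b\<close>. For \<open>b < k\<close> the binding constraint is
  \<open>a \<le> n\<close>; for \<open>b = k + j\<close> it is \<open>a \<le> n - 1 - j\<close>. The
  two ranges match the two sources of separated products below.\<close>

lemma sum_triples:
  fixes F :: "nat \<Rightarrow> nat \<Rightarrow> nat \<Rightarrow> 'r"
  shows "(\<Sum>(a, b, c) | a + b + c + 1 = k + n \<and> a \<le> n. F a b c) =
    (\<Sum>b<k. \<Sum>a\<le>n. F a b (k - 1 - b + n - a)) + (\<Sum>j<n. \<Sum>a\<le>n - 1 - j. F a (k + j) (n - 1 - j - a))"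
proof -
  let ?S = "\<lambda>b. {a. a \<le> n \<and> a + b < k + n}"
  have split: "(\<Sum>b<k + n. f b) = (\<Sum>b<k. f b) + (\<Sum>j<n. f (k + j))" for f :: "nat \<Rightarrow> 'r"
    by (induction n) (simp_all add: add.assoc)
  have "(\<Sum>(a, b, c) | a + b + c + 1 = k + n \<and> a \<le> n. F a b c) =
      (\<Sum>(b, a)\<in>(SIGMA b:{..<k + n}. ?S b). F a b (k + n - 1 - b - a))"
    by (rule sum.reindex_bij_witness[of _ "\<lambda>(b, a). (a, b, k + n - 1 - b - a)" "\<lambda>(a, b, c). (b, a)"])
       (auto intro!: arg_cong[of _ _ "F _ _"])
  also have "\<dots> = (\<Sum>b<k + n. \<Sum>a\<in>?S b. F a b (k + n - 1 - b - a))"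
    by (subst sum.Sigma) auto
  also have "\<dots> = (\<Sum>b<k. \<Sum>a\<in>?S b. F a b (k + n - 1 - b - a)) + (\<Sum>j<n. \<Sum>a\<in>?S (k + j). F a (k + j) (k + n - 1 - (k + j) - a))"
    by (rule split)
  also have "(\<Sum>b<k. \<Sum>a\<in>?S b. F a b (k + n - 1 - b - a)) = (\<Sum>b<k. \<Sum>a\<le>n. F a b (k - 1 - b + n - a))"
    by (intro sum.cong refl) (auto intro!: arg_cong[of _ _ "F _ _"])
  also have "(\<Sum>j<n. \<Sum>a\<in>?S (k + j). F a (k + j) (k + n - 1 - (k + j) - a)) =
      (\<Sum>j<n. \<Sum>a\<le>n - 1 - j. F a (k + j) (n - 1 - j - a))"
    by (intro sum.cong refl) (auto intro!: arg_cong[of _ _ "F _ _"])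
  finally show ?thesis .
qed

text \<open>First \<open>wsum_move_step_power\<close> clears the steps from the clique, then
  \<open>wsum_product_clique_at\<close> handles the clique at the center. Both subtracted sums are
  expanded by \<open>wsum_clique_at\<close> and merge by \<open>sum_triples\<close>. With
  \<open>n\<close> for \<open>m - 1\<close>, the condition on the triples avoids truncated
  subtraction.\<close>

proposition spider_identity:
  "wsum (\<lambda>i. (step ^^ p) f i * (step ^^ q) g i * (step ^^ k) (clique_at n) i) =
     (\<Sum>z\<le>n. elem C (n - z) * wsum (\<lambda>i. f i * (step ^^ (p + q + k + z)) g i))
     - (\<Sum>(a, b, c) | a + b + c + 1 = k + n \<and> a \<le> n.
          (1 - of_nat a) * (elem C a * (wsum ((step ^^ (b + p)) f) * wsum ((step ^^ (c + q)) g))))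
     + (\<Sum>z<k. wsum ((step ^^ z) (clique_at n)) * wsum (\<lambda>i. f i * (step ^^ (p + q + k - z - 1)) g i))"
proof -
  let ?P = "\<lambda>r. wsum (\<lambda>i. f i * (step ^^ r) g i)"
  let ?M = "\<lambda>r j. wsum (\<lambda>i. (step ^^ r) g i * clique_at j i)"
  let ?F = "\<lambda>a b c. (1 - of_nat a) * (elem C a * (wsum ((step ^^ (b + p)) f) * wsum ((step ^^ (c + q)) g)))"
  have M: "?M r j = (\<Sum>a\<le>j. (1 - of_nat a) * (elem C a * wsum ((step ^^ (j - a + r)) g)))" for r j
    by (simp add: wsum_clique_at funpow_add del: Nat.add_diff_assoc2)
  have 1: "(\<Sum>j<k. wsum (\<lambda>i. (step ^^ (p + j)) f i * (step ^^ q) g i) * wsum ((step ^^ (k - 1 - j)) (clique_at n)))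
      = (\<Sum>z<k. wsum ((step ^^ z) (clique_at n)) * ?P (p + q + k - z - 1))"
  \<comment> \<open>Reversing the order makes \<open>z\<close> the number of steps still on the
    clique, that is, the tail length of the lollipop.\<close>
  proof (rule sum.reindex_bij_witness[of _ "\<lambda>z. k - 1 - z" "\<lambda>z. k - 1 - z"], goal_cases)
    case (5 j)
    then have "p + q + k - (k - 1 - j) - 1 = p + j + q" by auto
    then show ?case by (simp only: wsum_step_power_adjoint) (rule mult.commute)
  qed auto
  have 2: "(\<Sum>j<k. wsum ((step ^^ (p + j)) f) * wsum (\<lambda>i. (step ^^ q) g i * (step ^^ (k - 1 - j)) (clique_at n) i))
      = (\<Sum>b<k. \<Sum>a\<le>n. ?F a b (k - 1 - b + n - a))"
  proof (intro sum.cong refl)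
    fix j assume "j \<in> {..<k}"
    \<comment> \<open>The steps left on the clique move over to \<open>g\<close>, so that the
      expansion \<open>M\<close> applies.\<close>
    have "wsum (\<lambda>i. (step ^^ q) g i * (step ^^ (k - 1 - j)) (clique_at n) i) = ?M (k - 1 - j + q) n"
      using wsum_step_power_adjoint[of "k - 1 - j" "(step ^^ q) g" 0 "clique_at n"] by (simp add: funpow_add)
    then show "wsum ((step ^^ (p + j)) f) * wsum (\<lambda>i. (step ^^ q) g i * (step ^^ (k - 1 - j)) (clique_at n) i)
        = (\<Sum>a\<le>n. ?F a j (k - 1 - j + n - a))"
      unfolding M by (auto simp: sum_distrib_left algebra_simps intro!: sum.cong arg_cong[of _ _ "\<lambda>r. wsum ((step ^^ r) g)"])
  qed
  have 3: "(\<Sum>j<n. wsum ((step ^^ (p + k + j)) f) * ?M q (n - 1 - j)) = (\<Sum>j<n. \<Sum>a\<le>n - 1 - j. ?F a (k + j) (n - 1 - j - a))"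
    unfolding M by (intro sum.cong refl) (auto simp: sum_distrib_left algebra_simps intro!: sum.cong)
  have 4: "(\<Sum>z\<le>n. elem C (n - z) * wsum (\<lambda>i. (step ^^ (p + k + z)) f i * (step ^^ q) g i)) = (\<Sum>z\<le>n. elem C (n - z) * ?P (p + q + k + z))"
    by (simp only: wsum_step_power_adjoint) (simp only: ac_simps)
  show ?thesis
    unfolding wsum_move_step_power wsum_product_clique_at 1 2 3 4 sum_triples by (simp add: algebra_simps)
qed

end

subsection \<open>Coloring polynomials of rooted graphs\<close>

text \<open>The construction common to \<open>P_graph\<close> and \<open>S_graph\<close>:
  \<open>\<iota>\<close> embeds the attached graph, and \<open>c\<close> is the near end of the
  path, which doubles as the image of the root when the path has length 0. In
  \<open>leg_path\<close>, \<open>\<nu>\<close> names the inner vertices.\<close>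

definition leg_emb :: "'v \<Rightarrow> ('b \<Rightarrow> 'v) \<Rightarrow> 'b rgraph \<Rightarrow> nat \<Rightarrow> 'b \<Rightarrow> 'v" where
  "leg_emb c \<iota> G t = (\<lambda>w. if t = 0 \<and> w = root G then c else \<iota> w)"

definition leg_path :: "'v \<Rightarrow> ('b \<Rightarrow> 'v) \<Rightarrow> (nat \<Rightarrow> 'v) \<Rightarrow> 'b rgraph \<Rightarrow> nat \<Rightarrow> nat \<Rightarrow> 'v" where
  "leg_path c \<iota> \<nu> G t = (\<lambda>j. if j = 0 then c else if j = t then leg_emb c \<iota> G t (root G) else \<nu> j)"

definition path_verts :: "('b \<Rightarrow> 'v) \<Rightarrow> (nat \<Rightarrow> 'v) \<Rightarrow> 'b rgraph \<Rightarrow> nat \<Rightarrow> 'v set" where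
  "path_verts e q G t = e ` verts G \<union> q ` {0..t}"

definition path_adj :: "('b \<Rightarrow> 'v) \<Rightarrow> (nat \<Rightarrow> 'v) \<Rightarrow> 'b rgraph \<Rightarrow> nat \<Rightarrow> 'v \<Rightarrow> 'v \<Rightarrow> bool" where
  "path_adj e q G t = (\<lambda>u v. (\<exists>a b. u = e a \<and> v = e b \<and> adj G a b)
     \<or> (\<exists>j<t. (u = q j \<and> v = q (Suc j)) \<or> (u = q (Suc j) \<and> v = q j)))"

definition edges_within :: "'v set \<Rightarrow> ('v \<Rightarrow> 'v \<Rightarrow> bool) \<Rightarrow> bool" where
  "edges_within V A \<longleftrightarrow> (\<forall>u v. A u v \<longrightarrow> u \<in> V \<and> v \<in> V \<and> u \<noteq> v)"

lemma edges_withinD: "edges_within V A \<Longrightarrow> A u v \<Longrightarrow> u \<in> V \<and> v \<in> V \<and> u \<noteq> v"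
  by (auto simp: edges_within_def)

lemma edges_within_adj: "rgraph_wf G \<Longrightarrow> edges_within (verts G) (adj G)"
  unfolding rgraph_wf_def edges_within_def by blast

lemma edges_within_union:
  "edges_within U A \<Longrightarrow> edges_within V B \<Longrightarrow> edges_within (U \<union> V) (\<lambda>u v. A u v \<or> B u v)"
  unfolding edges_within_def by blast

lemma finite_path_verts: "rgraph_wf G \<Longrightarrow> finite (path_verts e q G t)"
  by (simp add: path_verts_def rgraph_wf_def)

lemma edges_within_path:
  assumes "rgraph_wf G" "inj_on e (verts G)" "inj_on q {0..t}"
  shows "edges_within (path_verts e q G t) (path_adj e q G t)"
proof -
  have "q j \<noteq> q (Suc j)" if "j < t" for j
    using that inj_onD[OF assms(3), of j "Suc j"] by auto
  moreover have "u \<in> verts G" "v \<in> verts G" "e u \<noteq> e v" if "adj G u v" for u v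
    using that edges_withinD[OF edges_within_adj[OF assms(1)], of u v] inj_onD[OF assms(2), of u v] by auto
  ultimately show ?thesis
    unfolding edges_within_def path_verts_def path_adj_def
    by (fastforce simp: image_iff)
qed

lemma finite_verts_P_graph: "rgraph_wf G \<Longrightarrow> rgraph_wf H \<Longrightarrow> finite (verts (P_graph k G H))"
  by (simp add: P_graph_def Let_def rgraph_wf_def)

lemma finite_verts_S_graph:
  "rgraph_wf F \<Longrightarrow> rgraph_wf G \<Longrightarrow> rgraph_wf H \<Longrightarrow> finite (verts (S_graph a b d F G H))"
  by (simp add: S_graph_def Let_def rgraph_wf_def)

lemma rgraph_wf_Kc: "m \<ge> 1 \<Longrightarrow> rgraph_wf (Kc m)"
  by (auto simp: rgraph_wf_def Kc_def)

context color_weights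
begin

section \<open>Generating functions of proper colorings\<close>

definition colorings :: "('v \<Rightarrow> 'v \<Rightarrow> bool) \<Rightarrow> 'v set \<Rightarrow> ('v \<Rightarrow> 'c) set" where
  "colorings A V = {\<kappa> \<in> V \<rightarrow>\<^sub>E C. \<forall>u\<in>V. \<forall>v\<in>V. A u v \<longrightarrow> \<kappa> u \<noteq> \<kappa> v}"

definition chrom_poly :: "'v rgraph \<Rightarrow> 'r" where
  "chrom_poly G = (\<Sum>\<kappa>\<in>colorings (adj G) (verts G). \<Prod>v\<in>verts G. x (\<kappa> v))"

text \<open>The weight of the root is left out, so that gluing graphs at their roots corresponds to
  multiplication.\<close>

definition rooted_poly :: "('v \<Rightarrow> 'v \<Rightarrow> bool) \<Rightarrow> 'v set \<Rightarrow> 'v \<Rightarrow> 'c \<Rightarrow> 'r" where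
  "rooted_poly A V c i = (\<Sum>\<kappa> | \<kappa> \<in> colorings A V \<and> \<kappa> c = i. \<Prod>v\<in>V - {c}. x (\<kappa> v))"

abbreviation root_poly :: "'v rgraph \<Rightarrow> 'c \<Rightarrow> 'r" where
  "root_poly G \<equiv> rooted_poly (adj G) (verts G) (root G)"

lemma finite_colorings: "finite V \<Longrightarrow> finite (colorings A V)"
  unfolding colorings_def using finite_C by (intro finite_subset[OF _ finite_PiE[of V "\<lambda>_. C"]]) auto

text \<open>Taking \<open>D = C\<close> recovers the full polynomial from the rooted one; taking
  \<open>D = C - {i}\<close> describes a root adjacent to a new vertex of color
  \<open>i\<close>.\<close>

lemma sum_colorings_by_root:
  assumes "finite V" "c \<in> V" "D \<subseteq> C"
  shows "(\<Sum>\<kappa> | \<kappa> \<in> colorings A V \<and> \<kappa> c \<in> D. \<Prod>v\<in>V. x (\<kappa> v)) = (\<Sum>i\<in>D. x i * rooted_poly A V c i)"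
proof -
  have fin: "finite D" "finite {\<kappa>. \<kappa> \<in> colorings A V \<and> \<kappa> c \<in> D}"
    using assms finite_C finite_colorings[OF assms(1), of A] by (auto intro: finite_subset)
  have "(\<Sum>\<kappa> | \<kappa> \<in> colorings A V \<and> \<kappa> c \<in> D. \<Prod>v\<in>V. x (\<kappa> v)) =
      (\<Sum>i\<in>D. \<Sum>\<kappa> | \<kappa> \<in> {\<kappa>. \<kappa> \<in> colorings A V \<and> \<kappa> c \<in> D} \<and> \<kappa> c = i. \<Prod>v\<in>V. x (\<kappa> v))"
    by (rule sum.group[symmetric]) (use fin in auto)
  also have "\<dots> = (\<Sum>i\<in>D. x i * rooted_poly A V c i)"
    unfolding rooted_poly_def sum_distrib_left
    by (intro sum.cong refl) (auto simp: prod.remove[OF assms(1,2)])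
  finally show ?thesis .
qed

lemma chrom_poly_root_poly:
  assumes "finite (verts G)" "root G \<in> verts G"
  shows "chrom_poly G = wsum (root_poly G)"
proof -
  have "{\<kappa>. \<kappa> \<in> colorings (adj G) (verts G) \<and> \<kappa> (root G) \<in> C} = colorings (adj G) (verts G)"
    using assms by (auto simp: colorings_def)
  then show ?thesis
    using sum_colorings_by_root[OF assms order_refl, of "adj G"] by (simp add: chrom_poly_def wsum_def)
qed

text \<open>Invariance under relabeling, for the copies of graphs that sit inside sum types.\<close>

lemma rooted_poly_image:
  assumes inj: "inj_on f V" and c: "c \<in> V"
    and adj: "\<And>u v. u \<in> V \<Longrightarrow> v \<in> V \<Longrightarrow> B (f u) (f v) = A u v"
  shows "rooted_poly B (f ` V) (f c) i = rooted_poly A V c i"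
  unfolding rooted_poly_def
proof (rule sum.reindex_bij_witness[of _ "\<lambda>\<kappa>. \<lambda>y\<in>f ` V. \<kappa> (inv_into V f y)" "\<lambda>\<kappa>. restrict (\<kappa> \<circ> f) V"], goal_cases)
  case (1 \<kappa>)
  then show ?case using inj by (auto simp: colorings_def fun_eq_iff PiE_def extensional_def)
next
  case (2 \<kappa>)
  then show ?case using c adj by (auto simp: colorings_def)
next
  case (3 \<kappa>)
  then show ?case using inj by (auto simp: colorings_def fun_eq_iff PiE_def extensional_def)
next
  case (4 \<kappa>)
  then show ?case using c adj inj by (auto simp: colorings_def)
next
  case (5 \<kappa>)
  have "f ` V - {f c} = f ` (V - {c})" "inj_on f (V - {c})"
    using inj c by (auto simp: inj_on_def)
  then show ?case by (auto simp: prod.reindex intro!: prod.cong)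
qed

text \<open>Once the color of \<open>c\<close> is fixed, a coloring of the union is an arbitrary
  pair of colorings of the parts. The weights multiply because \<open>c\<close> itself carries
  none.\<close>

lemma rooted_poly_glue:
  assumes fin: "finite U" "finite V" and UV: "U \<inter> V = {c}"
    and A: "edges_within U A" and B: "edges_within V B"
  shows "rooted_poly (\<lambda>u v. A u v \<or> B u v) (U \<union> V) c i = rooted_poly A U c i * rooted_poly B V c i"
proof -
  have c: "c \<in> U" "c \<in> V" and only_c: "\<And>v. v \<in> U \<Longrightarrow> v \<in> V \<Longrightarrow> v = c" using UV by auto
  let ?X = "\<lambda>A V. {\<kappa>. \<kappa> \<in> colorings A V \<and> \<kappa> c = i}"
  have "rooted_poly A U c i * rooted_poly B V c i =
      (\<Sum>(\<kappa>, \<mu>)\<in>?X A U \<times> ?X B V. (\<Prod>v\<in>U - {c}. x (\<kappa> v)) * (\<Prod>v\<in>V - {c}. x (\<mu> v)))"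
    by (simp add: rooted_poly_def sum_product sum.cartesian_product)
  also have "\<dots> = rooted_poly (\<lambda>u v. A u v \<or> B u v) (U \<union> V) c i"
    unfolding rooted_poly_def
  proof (rule sum.reindex_bij_witness[of _ "\<lambda>\<kappa>. (restrict \<kappa> U, restrict \<kappa> V)"
        "\<lambda>(\<kappa>, \<mu>) v. if v \<in> U then \<kappa> v else \<mu> v"], goal_cases)
    case (1 p)
    then show ?case using only_c
      by (force simp: colorings_def fun_eq_iff PiE_def extensional_def restrict_def)
  next
    case (2 p)
    then obtain \<kappa> \<mu> where p: "p = (\<kappa>, \<mu>)" and "\<kappa> \<in> ?X A U" "\<mu> \<in> ?X B V" by auto
    then have \<kappa>: "\<kappa> \<in> U \<rightarrow>\<^sub>E C" "\<And>u v. A u v \<Longrightarrow> \<kappa> u \<noteq> \<kappa> v" "\<kappa> c = i"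
      and \<mu>: "\<mu> \<in> V \<rightarrow>\<^sub>E C" "\<And>u v. B u v \<Longrightarrow> \<mu> u \<noteq> \<mu> v" "\<mu> c = i"
      using edges_withinD[OF A] edges_withinD[OF B] by (auto simp: colorings_def)
    let ?f = "\<lambda>v. if v \<in> U then \<kappa> v else \<mu> v"
    \<comment> \<open>The case distinction in \<open>?f\<close> favors \<open>U\<close>, but the two
      colorings agree at the only common vertex, where both take the value \<open>i\<close>.\<close>
    have f: "\<And>v. v \<in> U \<Longrightarrow> ?f v = \<kappa> v" "\<And>v. v \<in> V \<Longrightarrow> ?f v = \<mu> v"
      using only_c \<kappa>(3) \<mu>(3) by auto
    have "?f u \<noteq> ?f v" if "A u v \<or> B u v" for u v
      using that
    proof
      assume "A u v" then show ?thesis using edges_withinD[OF A, of u v] \<kappa>(2)[of u v] f(1) by simp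
    next
      assume "B u v" then show ?thesis using edges_withinD[OF B, of u v] \<mu>(2)[of u v] f(2)[of u] f(2)[of v] by simp
    qed
    moreover have "?f \<in> (U \<union> V) \<rightarrow>\<^sub>E C" using \<kappa>(1) \<mu>(1) by (auto simp: PiE_def extensional_def)
    ultimately show ?case using c \<kappa>(3) unfolding p by (auto simp: colorings_def)
  next
    case (3 \<kappa>)
    then show ?case by (auto simp: colorings_def fun_eq_iff PiE_def extensional_def)
  next
    case (4 \<kappa>)
    then show ?case using c by (auto simp: colorings_def)
  next
    case (5 p)
    then obtain \<kappa> \<mu> where p: "p = (\<kappa>, \<mu>)" by auto
    have "(U \<union> V) - {c} = (U - {c}) \<union> (V - {c})" "(U - {c}) \<inter> (V - {c}) = {}" using UV by auto
    then have "(\<Prod>v\<in>(U \<union> V) - {c}. x (if v \<in> U then \<kappa> v else \<mu> v)) =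
       (\<Prod>v\<in>U - {c}. x (if v \<in> U then \<kappa> v else \<mu> v)) * (\<Prod>v\<in>V - {c}. x (if v \<in> U then \<kappa> v else \<mu> v))"
      using fin by (simp add: prod.union_disjoint)
    also have "(\<Prod>v\<in>U - {c}. x (if v \<in> U then \<kappa> v else \<mu> v)) = (\<Prod>v\<in>U - {c}. x (\<kappa> v))"
      by (intro prod.cong) auto
    also have "(\<Prod>v\<in>V - {c}. x (if v \<in> U then \<kappa> v else \<mu> v)) = (\<Prod>v\<in>V - {c}. x (\<mu> v))"
      using only_c by (intro prod.cong) auto
    finally show ?case by (simp add: p)
  qed
  finally show ?thesis ..
qed

text \<open>The old root \<open>r\<close> may take any color other than \<open>i\<close>, and its
  weight now counts. Summing over \<open>C - {i}\<close> is the full \<open>wsum\<close> without its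
  term at \<open>i\<close>, which is \<open>step\<close>.\<close>

lemma rooted_poly_pendant:
  assumes fin: "finite V" and r: "r \<in> V" and c: "c \<notin> V" and A: "edges_within V A" and i: "i \<in> C"
  shows "rooted_poly (\<lambda>u v. A u v \<or> u = c \<and> v = r \<or> u = r \<and> v = c) (insert c V) c i = step (rooted_poly A V r) i"
    (is "rooted_poly ?B _ _ _ = _")
proof -
  have nA: "\<not> A c v" "\<not> A v c" for v using edges_withinD[OF A, of c v] edges_withinD[OF A, of v c] c by auto
  have "rooted_poly ?B (insert c V) c i = (\<Sum>\<kappa> | \<kappa> \<in> colorings A V \<and> \<kappa> r \<in> C - {i}. \<Prod>v\<in>V. x (\<kappa> v))"
    unfolding rooted_poly_def
  proof (rule sum.reindex_bij_witness[of _ "\<lambda>\<kappa>. \<kappa>(c := i)" "\<lambda>\<kappa>. restrict \<kappa> V"], goal_cases)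
    case (1 \<kappa>)
    then show ?case by (auto simp: colorings_def fun_eq_iff PiE_def extensional_def)
  next
    case (2 \<kappa>)
    then show ?case using r by (auto simp: colorings_def)
  next
    case (3 \<kappa>)
    then show ?case using c by (auto simp: colorings_def fun_eq_iff PiE_def extensional_def)
  next
    case (4 \<kappa>)
    then show ?case using c r i nA by (auto simp: colorings_def PiE_def extensional_def)
  next
    case (5 \<kappa>)
    then show ?case using c by (auto intro!: prod.cong)
  qed
  also have "\<dots> = (\<Sum>j\<in>C - {i}. x j * rooted_poly A V r j)"
    by (rule sum_colorings_by_root) (use fin r in auto)
  also have "\<dots> = step (rooted_poly A V r) i"
    by (simp add: step_def wsum_def sum.remove[OF finite_C i])
  finally show ?thesis .
qed

text \<open>The path is peeled off at its free end: \<open>q 0\<close> is a pendant vertex on the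
  path shifted by \<open>Suc\<close>, so each edge contributes one \<open>step\<close>.\<close>

lemma rooted_poly_path:
  assumes G: "rgraph_wf G" and e: "inj_on e (verts G)" and q: "inj_on q {0..t}"
    and qt: "q t = e (root G)" and disj: "\<And>j. j < t \<Longrightarrow> q j \<notin> e ` verts G" and i: "i \<in> C"
  shows "rooted_poly (path_adj e q G t) (path_verts e q G t) (q 0) i = (step ^^ t) (root_poly G) i"
  using q qt disj i
proof (induction t arbitrary: q i)
  case 0
  have root: "root G \<in> verts G" using G by (simp add: rgraph_wf_def)
  have "path_adj e q G 0 (e u) (e v) = adj G u v" if "u \<in> verts G" "v \<in> verts G" for u v
  proof
    assume "path_adj e q G 0 (e u) (e v)"
    then obtain a b where ab: "e u = e a" "e v = e b" "adj G a b" by (auto simp: path_adj_def)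
    then have "u = a" "v = b"
      using edges_withinD[OF edges_within_adj[OF G] ab(3)] that e by (auto dest: inj_onD)
    then show "adj G u v" using ab by simp
  qed (auto simp: path_adj_def)
  then have "rooted_poly (path_adj e q G 0) (e ` verts G) (e (root G)) i = root_poly G i"
    by (intro rooted_poly_image e root)
  moreover have "path_verts e q G 0 = e ` verts G" using 0 root by (auto simp: path_verts_def)
  ultimately show ?case using 0 by simp
next
  case (Suc t)
  let ?q = "q \<circ> Suc"
  have q: "inj_on ?q {0..t}" "?q t = e (root G)" "\<And>j. j < t \<Longrightarrow> ?q j \<notin> e ` verts G"
    using Suc.prems by (auto intro!: comp_inj_on inj_on_subset[OF Suc.prems(1)])
  have new: "q 0 \<notin> path_verts e ?q G t"
  proof
    assume "q 0 \<in> path_verts e ?q G t"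
    then obtain j where "j \<le> t" "q 0 = q (Suc j)" using Suc.prems(3)[of 0] by (auto simp: path_verts_def)
    then show False using inj_onD[OF Suc.prems(1), of 0 "Suc j"] by auto
  qed
  have verts: "path_verts e q G (Suc t) = insert (q 0) (path_verts e ?q G t)"
    unfolding path_verts_def atLeast0_atMost_Suc_eq_insert_0 image_comp[symmetric] by auto
  have adj: "path_adj e q G (Suc t) = (\<lambda>u v. path_adj e ?q G t u v \<or> u = q 0 \<and> v = ?q 0 \<or> u = ?q 0 \<and> v = q 0)"
    by (auto simp: path_adj_def fun_eq_iff Ex_less_Suc2)
  have "rooted_poly (path_adj e q G (Suc t)) (path_verts e q G (Suc t)) (q 0) i =
      step (rooted_poly (path_adj e ?q G t) (path_verts e ?q G t) (?q 0)) i"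
    unfolding verts adj using new q Suc.prems G e
    by (intro rooted_poly_pendant finite_path_verts edges_within_path) (auto simp: path_verts_def)
  also have "\<dots> = step ((step ^^ t) (root_poly G)) i"
    by (intro step_cong Suc.IH q Suc.prems)
  finally show ?case by simp
qed

section \<open>Legs attached to a common center\<close>

context
  fixes c :: 'v and \<iota> :: "'b \<Rightarrow> 'v" and \<nu> :: "nat \<Rightarrow> 'v" and G :: "'b rgraph" and t :: nat
  assumes G: "rgraph_wf G" and \<iota>: "inj \<iota>" "c \<notin> range \<iota>" and \<nu>: "inj \<nu>" "c \<notin> \<nu> ` {1..}" "\<And>j w. \<nu> j \<noteq> \<iota> w"
begin

abbreviation "leg_verts \<equiv> path_verts (leg_emb c \<iota> G t) (leg_path c \<iota> \<nu> G t) G t"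
abbreviation "leg_adj \<equiv> path_adj (leg_emb c \<iota> G t) (leg_path c \<iota> \<nu> G t) G t"

lemma inj_leg: "inj_on (leg_emb c \<iota> G t) (verts G)" "inj_on (leg_path c \<iota> \<nu> G t) {0..t}"
  using \<iota> \<nu> \<nu>(3)[symmetric] by (auto simp: inj_on_def inj_def leg_emb_def leg_path_def)

lemma edges_within_leg: "edges_within leg_verts leg_adj"
  by (rule edges_within_path[OF G inj_leg])

lemma center_leg: "c \<in> leg_verts"
  by (auto simp: path_verts_def leg_path_def intro!: image_eqI[of _ _ 0])

text \<open>This bound shows that legs built with disjoint embeddings meet only in
  \<open>c\<close>.\<close>

lemma leg_verts_subset: "leg_verts \<subseteq> insert c (range \<iota> \<union> \<nu> ` {1..})"
  by (auto simp: path_verts_def leg_path_def leg_emb_def)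

lemma rooted_poly_leg: "i \<in> C \<Longrightarrow> rooted_poly leg_adj leg_verts c i = (step ^^ t) (root_poly G) i"
proof -
  assume "i \<in> C"
  then have "rooted_poly leg_adj leg_verts (leg_path c \<iota> \<nu> G t 0) i = (step ^^ t) (root_poly G) i"
    using G \<iota> \<nu> by (intro rooted_poly_path inj_leg) (auto simp: leg_path_def leg_emb_def)
  then show ?thesis by (simp add: leg_path_def)
qed

end

section \<open>Chromatic polynomials of path joins and spiders\<close>

lemma chrom_poly_P_graph:
  fixes G :: "'u rgraph" and H :: "'w rgraph"
  assumes G: "rgraph_wf G" and H: "rgraph_wf H"
  shows "chrom_poly (P_graph k G H) = wsum (\<lambda>i. root_poly G i * (step ^^ k) (root_poly H) i)"
proof -
  let ?c = "Inl (root G) :: 'u + 'w + nat" and ?\<iota> = "\<lambda>w :: 'w. Inr (Inl w) :: 'u + 'w + nat" and ?\<nu> = "\<lambda>j :: nat. Inr (Inr j) :: 'u + 'w + nat"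
  let ?V = "path_verts (leg_emb ?c ?\<iota> H k) (leg_path ?c ?\<iota> ?\<nu> H k) H k"
    and ?A = "path_adj (leg_emb ?c ?\<iota> H k) (leg_path ?c ?\<iota> ?\<nu> H k) H k"
    and ?B = "\<lambda>u v. \<exists>a b. u = Inl a \<and> v = Inl b \<and> adj G a b"
  have root: "root G \<in> verts G" using G by (simp add: rgraph_wf_def)
  have leg: "inj ?\<iota>" "?c \<notin> range ?\<iota>" "inj ?\<nu>" "?c \<notin> ?\<nu> ` {1..}" "\<And>j w. ?\<nu> j \<noteq> ?\<iota> w"
    by (auto simp: inj_def)
  \<comment> \<open>The graph is \<open>G\<close> glued at its root to a leg carrying
    \<open>H\<close>; unfolding the definitions exhibits this decomposition.\<close>
  have verts: "verts (P_graph k G H) = Inl ` verts G \<union> ?V"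
    and adj: "adj (P_graph k G H) = (\<lambda>u v. ?B u v \<or> ?A u v)"
    and rt: "root (P_graph k G H) = ?c"
    by (simp_all add: P_graph_def Let_def path_verts_def path_adj_def leg_emb_def[abs_def] leg_path_def[abs_def] Un_assoc comp_def)
  have "root_poly (P_graph k G H) i = root_poly G i * (step ^^ k) (root_poly H) i" if "i \<in> C" for i
  proof -
    have "root_poly (P_graph k G H) i = rooted_poly ?B (Inl ` verts G) ?c i * rooted_poly ?A ?V ?c i"
      unfolding verts adj rt
    proof (rule rooted_poly_glue)
      show "Inl ` verts G \<inter> ?V = {?c}"
        using leg_verts_subset[OF H leg, of k] center_leg[OF H leg, of k] root by auto
      show "edges_within (Inl ` verts G) ?B"
        using edges_within_adj[OF G] by (auto simp: edges_within_def)
    qed (use G H leg in \<open>auto simp: rgraph_wf_def intro: finite_path_verts edges_within_leg\<close>)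
    also have "rooted_poly ?B (Inl ` verts G) ?c i = root_poly G i"
      by (rule rooted_poly_image) (use root in auto)
    also have "rooted_poly ?A ?V ?c i = (step ^^ k) (root_poly H) i"
      by (rule rooted_poly_leg) (use H leg that in auto)
    finally show ?thesis .
  qed
  moreover have "root (P_graph k G H) \<in> verts (P_graph k G H)" using root by (simp add: verts rt)
  ultimately show ?thesis
    by (simp add: chrom_poly_root_poly finite_verts_P_graph G H cong: wsum_cong)
qed

text \<open>The three legs are glued at the center, first two of them and then the third.\<close>

lemma chrom_poly_S_graph:
  fixes F :: "'u rgraph" and G :: "'v rgraph" and H :: "'w rgraph"
  assumes F: "rgraph_wf F" and G: "rgraph_wf G" and H: "rgraph_wf H"
  shows "chrom_poly (S_graph a b d F G H) =
    wsum (\<lambda>i. (step ^^ a) (root_poly F) i * (step ^^ b) (root_poly G) i * (step ^^ d) (root_poly H) i)"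
proof -
  let ?c = "Inr (0, 0) :: ('u + 'v + 'w) + nat \<times> nat" and ?\<nu> = "\<lambda>n j. Inr (n, j) :: ('u + 'v + 'w) + nat \<times> nat"
  let ?\<iota>1 = "\<lambda>w :: 'u. Inl (Inl w) :: ('u + 'v + 'w) + nat \<times> nat"
    and ?\<iota>2 = "\<lambda>w :: 'v. Inl (Inr (Inl w)) :: ('u + 'v + 'w) + nat \<times> nat"
    and ?\<iota>3 = "\<lambda>w :: 'w. Inl (Inr (Inr w)) :: ('u + 'v + 'w) + nat \<times> nat"
  let ?V1 = "path_verts (leg_emb ?c ?\<iota>1 F a) (leg_path ?c ?\<iota>1 (?\<nu> 1) F a) F a"
    and ?A1 = "path_adj (leg_emb ?c ?\<iota>1 F a) (leg_path ?c ?\<iota>1 (?\<nu> 1) F a) F a"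
    and ?V2 = "path_verts (leg_emb ?c ?\<iota>2 G b) (leg_path ?c ?\<iota>2 (?\<nu> 2) G b) G b"
    and ?A2 = "path_adj (leg_emb ?c ?\<iota>2 G b) (leg_path ?c ?\<iota>2 (?\<nu> 2) G b) G b"
    and ?V3 = "path_verts (leg_emb ?c ?\<iota>3 H d) (leg_path ?c ?\<iota>3 (?\<nu> 3) H d) H d"
    and ?A3 = "path_adj (leg_emb ?c ?\<iota>3 H d) (leg_path ?c ?\<iota>3 (?\<nu> 3) H d) H d"
  have leg1: "inj ?\<iota>1" "?c \<notin> range ?\<iota>1" "inj (?\<nu> 1)" "?c \<notin> ?\<nu> 1 ` {1..}" "\<And>j w. ?\<nu> 1 j \<noteq> ?\<iota>1 w"
    and leg2: "inj ?\<iota>2" "?c \<notin> range ?\<iota>2" "inj (?\<nu> 2)" "?c \<notin> ?\<nu> 2 ` {1..}" "\<And>j w. ?\<nu> 2 j \<noteq> ?\<iota>2 w"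
    and leg3: "inj ?\<iota>3" "?c \<notin> range ?\<iota>3" "inj (?\<nu> 3)" "?c \<notin> ?\<nu> 3 ` {1..}" "\<And>j w. ?\<nu> 3 j \<noteq> ?\<iota>3 w"
    by (auto simp: inj_def)
  have c: "?c \<in> ?V1" "?c \<in> ?V2" "?c \<in> ?V3"
    by (rule center_leg[OF F leg1] center_leg[OF G leg2] center_leg[OF H leg3])+
  have sub: "?V1 \<subseteq> insert ?c (range ?\<iota>1 \<union> ?\<nu> 1 ` {1..})" "?V2 \<subseteq> insert ?c (range ?\<iota>2 \<union> ?\<nu> 2 ` {1..})"
    "?V3 \<subseteq> insert ?c (range ?\<iota>3 \<union> ?\<nu> 3 ` {1..})"
    by (rule leg_verts_subset[OF F leg1] leg_verts_subset[OF G leg2] leg_verts_subset[OF H leg3])+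
  have meet: "?V1 \<inter> ?V2 \<subseteq> {?c}" "?V1 \<inter> ?V3 \<subseteq> {?c}" "?V2 \<inter> ?V3 \<subseteq> {?c}"
    by (rule order_trans[OF Int_mono[OF sub(1,2)]] order_trans[OF Int_mono[OF sub(1,3)]]
      order_trans[OF Int_mono[OF sub(2,3)]]; auto)+
  have fin: "finite ?V1" "finite ?V2" "finite ?V3" by (simp_all add: finite_path_verts F G H)
  have edges: "edges_within ?V1 ?A1" "edges_within ?V2 ?A2" "edges_within ?V3 ?A3"
    by (rule edges_within_leg[OF F leg1] edges_within_leg[OF G leg2] edges_within_leg[OF H leg3])+
  have "verts (S_graph a b d F G H) = insert ?c (?V1 \<union> ?V2 \<union> ?V3)"
    by (auto simp: S_graph_def Let_def path_verts_def leg_emb_def[abs_def] leg_path_def[abs_def] comp_def)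
  then have verts: "verts (S_graph a b d F G H) = ?V1 \<union> ?V2 \<union> ?V3" using c by auto
  have adj: "adj (S_graph a b d F G H) = (\<lambda>u v. (?A1 u v \<or> ?A2 u v) \<or> ?A3 u v)"
    by (auto simp: S_graph_def Let_def path_adj_def leg_emb_def[abs_def] leg_path_def[abs_def] comp_def fun_eq_iff)
  have rt: "root (S_graph a b d F G H) = ?c" by (simp add: S_graph_def Let_def)
  have "root_poly (S_graph a b d F G H) i =
      (step ^^ a) (root_poly F) i * (step ^^ b) (root_poly G) i * (step ^^ d) (root_poly H) i" if "i \<in> C" for i
  proof -
    have "root_poly (S_graph a b d F G H) i = rooted_poly (\<lambda>u v. ?A1 u v \<or> ?A2 u v) (?V1 \<union> ?V2) ?c i * rooted_poly ?A3 ?V3 ?c i"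
      unfolding verts adj rt
    proof (rule rooted_poly_glue)
      show "(?V1 \<union> ?V2) \<inter> ?V3 = {?c}" using meet c by blast
    qed (use fin edges edges_within_union in auto)
    also have "rooted_poly (\<lambda>u v. ?A1 u v \<or> ?A2 u v) (?V1 \<union> ?V2) ?c i = rooted_poly ?A1 ?V1 ?c i * rooted_poly ?A2 ?V2 ?c i"
    proof (rule rooted_poly_glue)
      show "?V1 \<inter> ?V2 = {?c}" using meet c by blast
    qed (use fin edges in auto)
    finally show ?thesis
      by (simp only: rooted_poly_leg[OF F leg1 that] rooted_poly_leg[OF G leg2 that] rooted_poly_leg[OF H leg3 that])
  qed
  moreover have "root (S_graph a b d F G H) \<in> verts (S_graph a b d F G H)" "finite (verts (S_graph a b d F G H))"
    using c fin by (simp_all add: verts rt)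
  ultimately show ?thesis
    by (simp add: chrom_poly_root_poly cong: wsum_cong)
qed

section \<open>Complete graphs and pendant paths\<close>

lemma sum_injective_colorings:
  assumes "finite B" "finite D"
  shows "(\<Sum>\<kappa> | \<kappa> \<in> B \<rightarrow>\<^sub>E D \<and> inj_on \<kappa> B. \<Prod>v\<in>B. x (\<kappa> v)) = of_nat (fact (card B)) * elem D (card B)"
  using assms
proof (induction B arbitrary: D rule: finite_induct)
  case empty
  then show ?case by (simp add: elem_0 Collect_conv_if)
next
  case (insert b B)
  let ?X = "\<lambda>D. {\<kappa>. \<kappa> \<in> B \<rightarrow>\<^sub>E D \<and> inj_on \<kappa> B}"
  have fin: "finite (?X (D - {i}))" for i
    using insert by (intro finite_subset[OF _ finite_PiE[of B "\<lambda>_. D"]]) auto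
  have "(\<Sum>\<kappa> | \<kappa> \<in> insert b B \<rightarrow>\<^sub>E D \<and> inj_on \<kappa> (insert b B). \<Prod>v\<in>insert b B. x (\<kappa> v)) =
      (\<Sum>(i, \<kappa>)\<in>(SIGMA i:D. ?X (D - {i})). x i * (\<Prod>v\<in>B. x (\<kappa> v)))"
  proof (rule sum.reindex_bij_witness[of _ "\<lambda>(i, \<kappa>). \<kappa>(b := i)" "\<lambda>\<kappa>. (\<kappa> b, restrict \<kappa> B)"], goal_cases)
    case (1 \<kappa>)
    then show ?case by (auto simp: fun_eq_iff PiE_def extensional_def)
  next
    case (2 \<kappa>)
    then show ?case using insert.hyps by (auto simp: inj_on_def PiE_def Pi_def)
  next
    case (3 p)
    then show ?case using insert.hyps by (auto simp: fun_eq_iff PiE_def extensional_def)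
  next
    case (4 p)
    then obtain i \<kappa> where "p = (i, \<kappa>)" "i \<in> D" "\<kappa> \<in> B \<rightarrow>\<^sub>E D - {i}" "inj_on \<kappa> B" by auto
    moreover from this have "\<kappa> v \<noteq> i" if "v \<in> B" for v using that by auto
    ultimately show ?case using insert.hyps by (auto simp: PiE_def extensional_def inj_on_def)
  next
    case (5 \<kappa>)
    then show ?case using insert.hyps by (auto intro!: prod.cong)
  qed
  also have "\<dots> = (\<Sum>i\<in>D. \<Sum>\<kappa>\<in>?X (D - {i}). x i * (\<Prod>v\<in>B. x (\<kappa> v)))"
    using insert.prems fin by (subst sum.Sigma) auto
  also have "\<dots> = (\<Sum>i\<in>D. x i * (of_nat (fact (card B)) * elem (D - {i}) (card B)))"
    using insert by (simp add: sum_distrib_left[symmetric])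
  also have "\<dots> = of_nat (fact (card B)) * (\<Sum>i\<in>D. x i * elem (D - {i}) (card B))"
    by (simp add: sum_distrib_left algebra_simps)
  \<comment> \<open>Euler's identity \<open>sum_elem_remove\<close> turns the sum over the color of
    \<open>b\<close> into the factor \<open>card B + 1\<close> that extends the factorial.\<close>
  also have "\<dots> = of_nat (fact (card (insert b B))) * elem D (card (insert b B))"
    using insert by (simp add: sum_elem_remove algebra_simps)
  finally show ?case .
qed

text \<open>With the root colored \<open>i\<close>, the other \<open>m - 1\<close> vertices receive
  distinct colors from \<open>C - {i}\<close>; each set of \<open>m - 1\<close> colors arises from
  \<open>(m - 1)!\<close> colorings.\<close>

lemma root_poly_Kc:
  assumes m: "m \<ge> 1" and i: "i \<in> C"
  shows "root_poly (Kc m) i = of_nat (fact (m - 1)) * clique_at (m - 1) i"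
proof -
  have "root_poly (Kc m) i = (\<Sum>\<kappa> | \<kappa> \<in> {1..<m} \<rightarrow>\<^sub>E C - {i} \<and> inj_on \<kappa> {1..<m}. \<Prod>v\<in>{1..<m}. x (\<kappa> v))"
    unfolding rooted_poly_def
  proof (rule sum.reindex_bij_witness[of _ "\<lambda>\<kappa>. \<kappa>(0 := i)" "\<lambda>\<kappa>. restrict \<kappa> {1..<m}"], goal_cases)
    case (1 \<kappa>)
    then show ?case by (auto simp: colorings_def Kc_def fun_eq_iff PiE_def extensional_def)
  next
    case (2 \<kappa>)
    then have "\<kappa> \<in> {0..<m} \<rightarrow>\<^sub>E C" "\<kappa> 0 = i" "\<And>u v. u < m \<Longrightarrow> v < m \<Longrightarrow> u \<noteq> v \<Longrightarrow> \<kappa> u \<noteq> \<kappa> v"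
      by (auto simp: colorings_def Kc_def)
    moreover from this(3)[of _ 0] have "\<kappa> u \<noteq> \<kappa> 0" if "1 \<le> u" "u < m" for u using that by simp
    ultimately show ?case by (fastforce simp: inj_on_def PiE_def Pi_def)
  next
    case (3 \<kappa>)
    then show ?case by (auto simp: fun_eq_iff PiE_def extensional_def)
  next
    case (4 \<kappa>)
    have \<kappa>: "\<kappa> v \<in> C" "\<kappa> v \<noteq> i" if "1 \<le> v" "v < m" for v using 4 that by auto
    have "\<kappa> u \<noteq> \<kappa> v" if "1 \<le> u" "u < m" "1 \<le> v" "v < m" "u \<noteq> v" for u v
      using 4 that by (auto dest: inj_onD)
    moreover have "\<kappa> v = undefined" if "\<not> v < m" for v using 4 that by (auto simp: PiE_def extensional_def)
    ultimately show ?case using \<kappa> m i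
      by (auto simp: colorings_def Kc_def PiE_def extensional_def Suc_le_eq) metis+
  next
    case (5 \<kappa>)
    have "verts (Kc m) - {root (Kc m)} = {1..<m}" by (auto simp: Kc_def)
    then show ?case by (auto intro!: prod.cong)
  qed
  then show ?thesis using sum_injective_colorings[of "{1..<m}" "C - {i}"] finite_C by (simp add: clique_at_def)
qed

lemma chrom_poly_pend: "rgraph_wf G \<Longrightarrow> chrom_poly (pend k G) = wsum ((step ^^ k) (root_poly G))"
proof -
  assume "rgraph_wf G"
  then have "chrom_poly (pend k G) = wsum (\<lambda>i. root_poly G i * (step ^^ k) (root_poly (Kc 1)) i)"
    by (simp add: pend_def chrom_poly_P_graph rgraph_wf_Kc)
  also have "\<dots> = wsum (\<lambda>i. root_poly G i * (step ^^ k) (\<lambda>_. 1) i)"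
    by (intro wsum_cong arg_cong2[of _ _ _ _ times] refl step_power_cong) (auto simp: root_poly_Kc clique_at_0)
  finally show ?thesis by (simp add: wsum_step_power_one)
qed

text \<open>The identity is multiplied by \<open>(m - 1)!\<close>, so it makes sense in any
  commutative ring. In the last sum the factorial is absorbed by the lollipops.\<close>

proposition chrom_poly_S_graph_Kc:
  assumes G: "rgraph_wf G" and H: "rgraph_wf H" and m: "m \<ge> 1"
  shows "chrom_poly (S_graph g h k G H (Kc m)) =
     of_nat (fact (m - 1)) *
      ((\<Sum>z\<in>{0..m - 1}. elem C (m - 1 - z) * chrom_poly (P_graph (g + h + k + z) G H))
       - (\<Sum>(a, b, c) | a + b + c + 2 = k + m \<and> a \<le> m - 1.
            (1 - of_nat a) * (elem C a * (chrom_poly (pend (b + g) G) * chrom_poly (pend (c + h) H)))))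
     + (\<Sum>z\<in>{0..<k}. chrom_poly (pend z (Kc m)) * chrom_poly (P_graph (g + h + k - z - 1) G H))"
proof -
  let ?n = "m - 1"
  have K: "(step ^^ j) (root_poly (Kc m)) i = of_nat (fact ?n) * (step ^^ j) (clique_at ?n) i" if "i \<in> C" for i j
    using step_power_cong[of "root_poly (Kc m)" "\<lambda>i. of_nat (fact ?n) * clique_at ?n i" i j] that m
    by (simp add: root_poly_Kc step_power_scale)
  have pK: "chrom_poly (pend z (Kc m)) = of_nat (fact ?n) * wsum ((step ^^ z) (clique_at ?n))" for z
    using m by (simp add: chrom_poly_pend rgraph_wf_Kc wsum_scale[symmetric] K cong: wsum_cong)
  have "chrom_poly (S_graph g h k G H (Kc m)) =
      wsum (\<lambda>i. of_nat (fact ?n) * ((step ^^ g) (root_poly G) i * (step ^^ h) (root_poly H) i * (step ^^ k) (clique_at ?n) i))"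
    using m by (simp add: chrom_poly_S_graph G H rgraph_wf_Kc K ac_simps cong: wsum_cong)
  then have *: "chrom_poly (S_graph g h k G H (Kc m)) =
      of_nat (fact ?n) * wsum (\<lambda>i. (step ^^ g) (root_poly G) i * (step ^^ h) (root_poly H) i * (step ^^ k) (clique_at ?n) i)"
    by (simp only: wsum_scale)
  have "a + b + c + 2 = k + m \<longleftrightarrow> a + b + c + 1 = k + ?n" for a b c using m by auto
  then show ?thesis
    unfolding * spider_identity
    by (simp add: chrom_poly_P_graph chrom_poly_pend pK G H atMost_atLeast0 lessThan_atLeast0 distrib_left sum_distrib_left mult.assoc)
qed

end

subsection \<open>Coefficients of power series\<close>

abbreviation "lookup \<equiv> Poly_Mapping.lookup"
abbreviation "keys \<equiv> Poly_Mapping.keys"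

text \<open>Only exponents supported below \<open>N\<close> are compared, so the polynomial may vary
  with \<open>N\<close>; every finitely supported exponent is reached once \<open>N\<close> is
  large.\<close>

definition represents :: "nat \<Rightarrow> sf \<Rightarrow> ((nat \<Rightarrow>\<^sub>0 nat) \<Rightarrow>\<^sub>0 rat) \<Rightarrow> bool" where
  "represents N f p \<longleftrightarrow> (\<forall>a. keys a \<subseteq> {..<N} \<longrightarrow> f (lookup a) = lookup p a)"

text \<open>The type \<open>sf\<close> also has coefficients at exponent vectors of infinite
  support, which no polynomial sees. There equality of two series comes from both coefficients being
  zero.\<close>

definition finitely_supported :: "sf \<Rightarrow> bool" where
  "finitely_supported f \<longleftrightarrow> (\<forall>\<alpha>. infinite {i. \<alpha> i \<noteq> 0} \<longrightarrow> f \<alpha> = 0)"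

lemma sf_eqI:
  assumes "finitely_supported f" "finitely_supported g" "\<And>N. represents N f (p N)" "\<And>N. represents N g (p N)"
  shows "f = g"
proof
  fix \<alpha> :: "nat \<Rightarrow> nat"
  show "f \<alpha> = g \<alpha>"
  proof (cases "finite {i. \<alpha> i \<noteq> 0}")
    case True
    then have \<alpha>: "\<alpha> = lookup (Abs_poly_mapping \<alpha>)" by simp
    obtain N where "keys (Abs_poly_mapping \<alpha>) \<subseteq> {..<N}"
      using finite_keys[of "Abs_poly_mapping \<alpha>"] unfolding finite_nat_set_iff_bounded by auto
    then show ?thesis using assms(3,4)[of N] \<alpha> unfolding represents_def by metis
  qed (use assms in \<open>simp add: finitely_supported_def\<close>)
qed

lemma finitely_supported_chrom: "finite (verts G) \<Longrightarrow> finitely_supported (chrom G)"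
  unfolding finitely_supported_def
proof (intro allI impI)
  fix \<alpha> :: "nat \<Rightarrow> nat"
  assume V: "finite (verts G)" and \<alpha>: "infinite {i. \<alpha> i \<noteq> 0}"
  have False if card: "\<And>i. card {v \<in> verts G. \<kappa> v = i} = \<alpha> i" for \<kappa>
  proof -
    have "i \<in> \<kappa> ` verts G" if i: "\<alpha> i \<noteq> 0" for i
    proof (rule ccontr)
      assume "i \<notin> \<kappa> ` verts G"
      then have empty: "{v \<in> verts G. \<kappa> v = i} = {}" by auto
      show False using card[of i] i unfolding empty by simp
    qed
    then have "finite {i. \<alpha> i \<noteq> 0}" using V by (auto intro: finite_subset[of _ "\<kappa> ` verts G"])
    then show False using \<alpha> by simp
  qed
  then have none: "{\<kappa> \<in> verts G \<rightarrow>\<^sub>E (UNIV :: nat set). (\<forall>x\<in>verts G. \<forall>y\<in>verts G. adj G x y \<longrightarrow> \<kappa> x \<noteq> \<kappa> y) \<and>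
      (\<forall>i. card {v \<in> verts G. \<kappa> v = i} = \<alpha> i)} = {}" by blast
  show "chrom G \<alpha> = 0" unfolding chrom_def none by simp
qed

lemma finitely_supported_esym: "finitely_supported (esym n)"
  by (simp add: finitely_supported_def esym_def)

text \<open>If \<alpha> has infinite support, so has \<beta> or the difference of \<alpha> and
  \<beta>; hence every summand of the convolution vanishes.\<close>

lemma finitely_supported_mult:
  assumes "finitely_supported f" "finitely_supported g"
  shows "finitely_supported (sf_mult f g)"
  unfolding finitely_supported_def
proof (intro allI impI)
  fix \<alpha> :: "nat \<Rightarrow> nat"
  assume inf: "infinite {i. \<alpha> i \<noteq> 0}"
  have "f \<beta> * g (\<lambda>i. \<alpha> i - \<beta> i) = 0" for \<beta>
  proof -
    have "{i. \<alpha> i \<noteq> 0} \<subseteq> {i. \<beta> i \<noteq> 0} \<union> {i. \<alpha> i - \<beta> i \<noteq> 0}" by auto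
    then have "infinite {i. \<beta> i \<noteq> 0} \<or> infinite {i. \<alpha> i - \<beta> i \<noteq> 0}"
      using inf finite_subset by blast
    then have "f \<beta> = 0 \<or> g (\<lambda>i. \<alpha> i - \<beta> i) = 0"
      using assms(1)[unfolded finitely_supported_def, rule_format, of \<beta>]
        assms(2)[unfolded finitely_supported_def, rule_format, of "\<lambda>i. \<alpha> i - \<beta> i"] by blast
    then show ?thesis by auto
  qed
  then show "sf_mult f g \<alpha> = 0" unfolding sf_mult_def by (intro sum.neutral) blast
qed

text \<open>\<open>sf_mult\<close> sums over plain functions, the polynomial product over finitely
  supported ones. Below a finitely supported bound the two index sets correspond and are
  finite.\<close>

lemma finite_below:
  fixes a :: "nat \<Rightarrow>\<^sub>0 nat"
  shows "finite {b :: nat \<Rightarrow>\<^sub>0 nat. \<forall>i. lookup b i \<le> lookup a i}"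
    and "bij_betw lookup {b :: nat \<Rightarrow>\<^sub>0 nat. \<forall>i. lookup b i \<le> lookup a i} {\<beta>. \<forall>i. \<beta> i \<le> lookup a i}"
proof -
  have "\<beta> \<in> lookup ` {b :: nat \<Rightarrow>\<^sub>0 nat. \<forall>i. lookup b i \<le> lookup a i}" if le: "\<forall>i. \<beta> i \<le> lookup a i" for \<beta>
  proof -
    have "{i. \<beta> i \<noteq> 0} \<subseteq> keys a"
    proof
      fix i assume "i \<in> {i. \<beta> i \<noteq> 0}"
      then show "i \<in> keys a" using le[rule_format, of i] by (simp add: in_keys_iff)
    qed
    then have "finite {i. \<beta> i \<noteq> 0}" by (rule finite_subset) simp
    then have "\<beta> = lookup (Abs_poly_mapping \<beta>)" by simp
    then show ?thesis using le by auto
  qed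
  moreover have inj: "inj (lookup :: (nat \<Rightarrow>\<^sub>0 nat) \<Rightarrow> _)" by (simp add: inj_def lookup_inject)
  ultimately show bij: "bij_betw lookup {b :: nat \<Rightarrow>\<^sub>0 nat. \<forall>i. lookup b i \<le> lookup a i} {\<beta>. \<forall>i. \<beta> i \<le> lookup a i}"
    unfolding bij_betw_def by (auto intro: inj_on_subset)
  \<comment> \<open>The union of the intervals serves as one finite codomain for all positions in
    \<open>keys a\<close>.\<close>
  have "finite {\<beta>. \<forall>i. (i \<in> keys a \<longrightarrow> \<beta> i \<in> (\<Union>i\<in>keys a. {..lookup a i})) \<and> (i \<notin> keys a \<longrightarrow> \<beta> i = 0)}"
    by (rule finite_set_of_finite_funs) auto
  then have "finite {\<beta>. \<forall>i. \<beta> i \<le> lookup a i}"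
    by (rule rev_finite_subset) (auto simp: in_keys_iff, metis le_zero_eq)
  then show "finite {b :: nat \<Rightarrow>\<^sub>0 nat. \<forall>i. lookup b i \<le> lookup a i}"
    using bij_betw_finite[OF bij] by simp
qed

text \<open>In the double sum over \<open>b\<close> and \<open>d\<close> with
  \<open>a = b + d\<close>, a suitable \<open>d\<close> exists exactly when \<open>b\<close> is
  pointwise below \<open>a\<close>, and then it is \<open>a - b\<close>.\<close>

lemma lookup_mult_below:
  fixes p q :: "(nat \<Rightarrow>\<^sub>0 nat) \<Rightarrow>\<^sub>0 'r::semiring_0"
  shows "lookup (p * q) a = (\<Sum>b | \<forall>i. lookup b i \<le> lookup a i. lookup p b * lookup q (a - b))"
proof -
  let ?D = "{b. \<forall>i. lookup b i \<le> lookup a i}"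
  have inner: "(\<Sum>d. lookup q d when a = b + d) = (lookup q (a - b) when b \<in> ?D)" for b
  proof (cases "b \<in> ?D")
    case True
    then have "a = b + d \<longleftrightarrow> d = a - b" for d
      by (auto simp: poly_mapping_eq_iff lookup_add lookup_minus fun_eq_iff)
    then show ?thesis using True by simp
  next
    case False
    then have "a \<noteq> b + d" for d by (auto simp: lookup_add)
    then show ?thesis using False by simp
  qed
  have "lookup (p * q) a = (\<Sum>b. lookup p b * (lookup q (a - b) when b \<in> ?D))"
    by (simp only: lookup_mult inner)
  also have "\<dots> = (\<Sum>b\<in>?D. lookup p b * (lookup q (a - b) when b \<in> ?D))"
    by (rule Sum_any.expand_superset[OF finite_below(1)]) (auto simp: when_def)
  finally show ?thesis by simp
qed

text \<open>Divisors of a monomial in the first \<open>N\<close> variables involve only those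
  variables, so restricting to them is compatible with products.\<close>

lemma represents_mult:
  assumes f: "represents N f p" and g: "represents N g q"
  shows "represents N (sf_mult f g) (p * q)"
  unfolding represents_def
proof (intro allI impI)
  fix a :: "nat \<Rightarrow>\<^sub>0 nat"
  assume a: "keys a \<subseteq> {..<N}"
  let ?D = "{b. \<forall>i. lookup b i \<le> lookup a i}"
  have "sf_mult f g (lookup a) = (\<Sum>b\<in>?D. f (lookup b) * g (\<lambda>i. lookup a i - lookup b i))"
    unfolding sf_mult_def by (rule sum.reindex_bij_betw[OF finite_below(2), symmetric])
  also have "\<dots> = (\<Sum>b\<in>?D. lookup p b * lookup q (a - b))"
  proof (intro sum.cong refl)
    fix b assume b: "b \<in> ?D"
    have below: "i < N" if "lookup a i \<noteq> 0" for i using subsetD[OF a, of i] that by (simp add: in_keys_iff)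
    have "keys b \<subseteq> {..<N}" "keys (a - b) \<subseteq> {..<N}"
      using below b by (auto simp: in_keys_iff lookup_minus) (metis le_zero_eq not_gr_zero)
    moreover have "(\<lambda>i. lookup a i - lookup b i) = lookup (a - b)" by (simp add: lookup_minus fun_eq_iff)
    ultimately show "f (lookup b) * g (\<lambda>i. lookup a i - lookup b i) = lookup p b * lookup q (a - b)"
      using f g by (simp add: represents_def)
  qed
  finally show "sf_mult f g (lookup a) = lookup (p * q) a" by (simp add: lookup_mult_below)
qed

lemma lookup_of_nat_mult: "lookup (of_nat n * p) a = of_nat n * lookup p a"
  for p :: "'a::monoid_add \<Rightarrow>\<^sub>0 'r::semiring_1"
  by (induction n) (simp_all add: lookup_add distrib_right)

lemma represents_add: "represents N f p \<Longrightarrow> represents N g q \<Longrightarrow> represents N (sf_add f g) (p + q)"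
  by (simp add: represents_def sf_add_def lookup_add)

lemma represents_diff: "represents N f p \<Longrightarrow> represents N g q \<Longrightarrow> represents N (sf_diff f g) (p - q)"
  by (simp add: represents_def sf_diff_def lookup_minus)

lemma represents_of_nat: "represents N f p \<Longrightarrow> represents N (sf_smult (of_nat n) f) (of_nat n * p)"
  by (simp add: represents_def sf_smult_def lookup_of_nat_mult)

lemma represents_one_minus_of_nat:
  "represents N f p \<Longrightarrow> represents N (sf_smult (1 - of_nat n) f) ((1 - of_nat n) * p)"
  by (simp add: represents_def sf_smult_def left_diff_distrib lookup_minus lookup_of_nat_mult)

section \<open>Polynomials representing the series of the theorem\<close>

definition monomial :: "nat \<Rightarrow> (nat \<Rightarrow>\<^sub>0 nat) \<Rightarrow>\<^sub>0 rat" where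
  "monomial i = Poly_Mapping.single (Poly_Mapping.single i 1) 1"

text \<open>The weight of a coloring is a single monomial whose exponents are the sizes of the color
  classes.\<close>

lemma lookup_prod_monomial:
  assumes "finite V"
  shows "lookup (\<Prod>v\<in>V. monomial (\<kappa> v)) a = (if \<forall>i. card {v \<in> V. \<kappa> v = i} = lookup a i then 1 else 0)"
proof -
  have "(\<Prod>v\<in>V. monomial (\<kappa> v)) = Poly_Mapping.single (\<Sum>v\<in>V. Poly_Mapping.single (\<kappa> v) 1) 1"
    using assms by (induction V rule: finite_induct) (simp_all add: monomial_def mult_single)
  moreover have "lookup (\<Sum>v\<in>V. Poly_Mapping.single (\<kappa> v) 1) i = card {v \<in> V. \<kappa> v = i}" for i
    using assms by (simp add: lookup_sum lookup_single when_def sum.If_cases Int_def conj_commute)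
  ultimately show ?thesis by (simp add: lookup_single when_def poly_mapping_eq_iff fun_eq_iff)
qed

text \<open>The weight of color \<open>i\<close> is the variable with index \<open>i\<close>, so the
  ring identity becomes one between polynomials in \<open>N\<close> variables.\<close>

interpretation monomials: color_weights "{..<N}" monomial for N :: nat
  by unfold_locales simp

text \<open>Every used color has a nonempty class and thus lies in \<open>keys a\<close>. Coloring
  with the first \<open>N\<close> colors therefore loses nothing at such an exponent.\<close>

lemma represents_chrom:
  assumes "finite (verts G)"
  shows "represents N (chrom G) (monomials.chrom_poly N G)"
  unfolding represents_def
proof (intro allI impI)
  fix a :: "nat \<Rightarrow>\<^sub>0 nat"
  assume a: "keys a \<subseteq> {..<N}"
  let ?K = "monomials.colorings N (adj G) (verts G)" and ?P = "\<lambda>\<kappa>. \<forall>i. card {v \<in> verts G. \<kappa> v = i} = lookup a i"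
  have "\<kappa> v < N" if "?P \<kappa>" "v \<in> verts G" for \<kappa> v
  proof -
    have "card {w \<in> verts G. \<kappa> w = \<kappa> v} \<noteq> 0" using that(2) assms by auto
    then have "\<kappa> v \<in> keys a" using that(1) by (metis in_keys_iff)
    then show ?thesis using a by auto
  qed
  then have "{\<kappa> \<in> verts G \<rightarrow>\<^sub>E (UNIV :: nat set). (\<forall>x\<in>verts G. \<forall>y\<in>verts G. adj G x y \<longrightarrow> \<kappa> x \<noteq> \<kappa> y) \<and> ?P \<kappa>}
      = {\<kappa> \<in> ?K. ?P \<kappa>}"
    by (auto simp: monomials.colorings_def PiE_def)
  then show "chrom G (lookup a) = lookup (monomials.chrom_poly N G) a"
    using monomials.finite_colorings[OF assms, of N "adj G"]
    by (simp add: chrom_def monomials.chrom_poly_def lookup_sum lookup_prod_monomial assms sum.If_cases Int_def)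
qed

lemma represents_esym: "represents N (esym n) (monomials.elem {..<N} n)"
  unfolding represents_def
proof (intro allI impI)
  fix a :: "nat \<Rightarrow>\<^sub>0 nat"
  assume a: "keys a \<subseteq> {..<N}"
  let ?A = "{S. S \<subseteq> {..<N} \<and> card S = n}"
  have fin: "finite ?A" by simp
  \<comment> \<open>This is the criterion of \<open>lookup_prod_monomial\<close> for the identity
    coloring of \<open>S\<close>: its classes have size 0 or 1, so only a squarefree exponent with
    support \<open>S\<close> can match.\<close>
  have iff: "(\<forall>i. card {v \<in> S. v = i} = lookup a i) \<longleftrightarrow> S = keys a \<and> (\<forall>i. lookup a i \<le> 1)" for S
  proof -
    have card: "card {v \<in> S. v = i} = (if i \<in> S then 1 else 0)" for i
    proof -
      have "{v \<in> S. v = i} = (if i \<in> S then {i} else {})" by auto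
      then show ?thesis by simp
    qed
    show ?thesis unfolding card
      by (auto simp: in_keys_iff le_Suc_eq split: if_splits)
  qed
  have "lookup (monomials.elem {..<N} n) a =
      (\<Sum>S\<in>?A. if S = keys a \<and> (\<forall>i. lookup a i \<le> 1) then 1 else 0)"
    unfolding monomials.elem_def lookup_sum iff[symmetric]
    by (intro sum.cong refl lookup_prod_monomial) (auto intro: finite_subset)
  also have "\<dots> = (if (\<forall>i. lookup a i \<le> 1) \<and> card (keys a) = n then 1 else 0)"
  proof (cases "\<forall>i. lookup a i \<le> 1")
    case True
    then show ?thesis using a fin by simp
  next
    case False
    then show ?thesis by (simp only: False simp_thms if_False sum.neutral_const)
  qed
  finally show "esym n (lookup a) = lookup (monomials.elem {..<N} n) a"
    by (simp add: esym_def Poly_Mapping.keys.rep_eq)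
qed

lemma represents_sum:
  "(\<And>i. i \<in> I \<Longrightarrow> represents N (F i) (p i)) \<Longrightarrow> represents N (sf_sum F I) (\<Sum>i\<in>I. p i)"
  unfolding represents_def sf_sum_def by (auto simp: lookup_sum intro!: sum.cong)

lemma finitely_supported_sum:
  "(\<And>i. i \<in> I \<Longrightarrow> finitely_supported (F i)) \<Longrightarrow> finitely_supported (sf_sum F I)"
  unfolding finitely_supported_def sf_sum_def by auto

theorem theorem4p5:
  fixes G :: "'a rgraph" and H :: "'b rgraph" and m h g k :: nat
  assumes "rgraph_wf G" and "rgraph_wf H" and "m \<ge> 1" and "h \<ge> 1"
  shows "sf_smult (1 / fact (m - 1)) (chrom (S_graph g h k G H (Kc m))) =
    sf_add
      (sf_diff
        (sf_sum (\<lambda>z. sf_mult (esym (m - 1 - z)) (chrom (P_graph (g + h + k + z) G H))) {0..m - 1})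
        (sf_sum (\<lambda>(a, b, c). sf_smult (1 - of_nat a)
                   (sf_mult (esym a) (sf_mult (chrom (pend (b + g) G)) (chrom (pend (c + h) H)))))
                {(a, b, c). a + b + c + 2 = k + m \<and> a \<le> m - 1}))
      (sf_smult (1 / fact (m - 1))
        (sf_sum (\<lambda>z. sf_mult (chrom (pend z (Kc m))) (chrom (P_graph (g + h + k - z - 1) G H))) {0..<k}))"
    (is "sf_smult ?r ?L = sf_add (sf_diff ?A ?B) (sf_smult ?r ?E)")
proof -
  note K = rgraph_wf_Kc[OF \<open>m \<ge> 1\<close>]
  have pendK: "finite (verts (pend j (Kc m)))" for j
    using K by (simp add: pend_def finite_verts_P_graph rgraph_wf_Kc)
  have fin: "finite (verts (P_graph j G H))" "finite (verts (pend j G))" "finite (verts (pend j H))"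
    "finite (verts (S_graph g h k G H (Kc m)))" for j
    using assms K by (simp_all add: pend_def finite_verts_P_graph rgraph_wf_Kc finite_verts_S_graph)
  let ?c = "of_nat (fact (m - 1)) :: rat"
  \<comment> \<open>The right-hand side multiplied by \<open>(m - 1)!\<close>, matching the
    division-free ring identity; the factorial is divided out at the end.\<close>
  let ?R = "sf_add (sf_smult ?c (sf_diff ?A ?B)) ?E"
  have "?L = ?R"
  proof (rule sf_eqI)
    show "finitely_supported ?L" by (intro finitely_supported_chrom fin)
    have "finitely_supported ?A" "finitely_supported ?E"
      by (intro finitely_supported_sum finitely_supported_mult finitely_supported_esym finitely_supported_chrom fin pendK)+
    moreover have "finitely_supported ?B"
    proof (rule finitely_supported_sum, clarify)
      fix a b c
      have "finitely_supported (sf_mult (esym a) (sf_mult (chrom (pend (b + g) G)) (chrom (pend (c + h) H))))"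
        by (intro finitely_supported_mult finitely_supported_esym finitely_supported_chrom fin)
      then show "finitely_supported (sf_smult (1 - of_nat a) (sf_mult (esym a) (sf_mult (chrom (pend (b + g) G)) (chrom (pend (c + h) H)))))"
        by (simp add: finitely_supported_def sf_smult_def)
    qed
    ultimately show "finitely_supported ?R"
      by (simp add: finitely_supported_def sf_add_def sf_smult_def sf_diff_def)
  next
    fix N
    show "represents N ?L (monomials.chrom_poly N (S_graph g h k G H (Kc m)))"
      by (intro represents_chrom fin)
    let ?e = "monomials.elem {..<N}"
    have A: "represents N ?A (\<Sum>z\<in>{0..m - 1}. ?e (m - 1 - z) * monomials.chrom_poly N (P_graph (g + h + k + z) G H))" (is "represents N _ ?pA")
      by (intro represents_sum represents_mult represents_esym represents_chrom fin)
    have B: "represents N ?B (\<Sum>(a, b, c) | a + b + c + 2 = k + m \<and> a \<le> m - 1.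
          (1 - of_nat a) * (?e a * (monomials.chrom_poly N (pend (b + g) G) * monomials.chrom_poly N (pend (c + h) H))))" (is "represents N _ ?pB")
      by (rule represents_sum, clarify)
         (intro represents_one_minus_of_nat represents_mult represents_esym represents_chrom fin)
    have E: "represents N ?E (\<Sum>z\<in>{0..<k}. monomials.chrom_poly N (pend z (Kc m)) * monomials.chrom_poly N (P_graph (g + h + k - z - 1) G H))" (is "represents N _ ?pE")
      by (intro represents_sum represents_mult represents_chrom fin pendK)
    \<comment> \<open>The ring identity equates this polynomial with the one representing
      \<open>?L\<close>, so both series share a representative for every \<open>N\<close>.\<close>
    have "represents N ?R (of_nat (fact (m - 1)) * (?pA - ?pB) + ?pE)"
      by (intro represents_add represents_of_nat represents_diff A B E)
    then show "represents N ?R (monomials.chrom_poly N (S_graph g h k G H (Kc m)))"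
      using monomials.chrom_poly_S_graph_Kc[OF assms(1-3), of N g h k] by simp
  qed
  then show ?thesis by (simp add: sf_add_def sf_smult_def sf_diff_def fun_eq_iff field_simps)
qed

end
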